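(* Let $A$ be an $n\times n$ unitary type-II matrix. For $j\in\{1,\dots,n\}$ let $D_j$ be the diagonal matrix whose $r$-th diagonal entry is the $r$-th entry of the $j$-th column of $\frac1{\sqrt n}A^{(-)}$. If $A$ is a spin model, then for each $j$ the column sets of the matrices $I$, $A$ and $D_jA$ form a set of three mutually unbiased bases of $\mathbb{C}^n$.
   Context: If all entries of a complex matrix $M$ are nonzero, its Schur inverse $M^{(-)}$ is the matrix with entries $(M^{(-)})_{i,j}=1/M_{i,j}$, and $M^{(-)T}$ denotes its transpose; likewise for vectors. An $n\times n$ complex matrix $M$ is a type-II matrix if it is invertible, all its entries are nonzero, and $MM^{(-)T}=nI$. For such $M$, let $M_{i/j}$ denote the vector that is the entrywise quotient of the $i$-th column of $M$ by the $j$-th column of $M$. A type-II matrix $W$ is a spin model if each of the vectors $W_{i/j}$ is an eigenvector of $W$. Two bases $x_1,\dots,x_n$ and $y_1,\dots,y_n$ of $\mathbb{C}^n$ are mutually unbiased if both are orthonormal and there is a constant $a$ such that $|\langle x_i,y_j\rangle|=a$ for all $i,j$. A set of mutually unbiased bases is a set of bases that are pairwise mutually unbiased. *)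

theory Defs
  imports
    "Jordan_Normal_Form.Schur_Decomposition"
    "Jordan_Normal_Form.VS_Connect"
begin

text \<open>Rows, columns and vector entries are numbered from \<open>0\<close> to \<open>n - 1\<close>.\<close>

text \<open>Since \<open>1 / 0 = 0\<close>, this is meaningful only if all entries of \<open>M\<close> are nonzero.\<close>

definition schur_inverse :: "complex mat \<Rightarrow> complex mat" where
  "schur_inverse M = map_mat (\<lambda>x. 1 / x) M"

definition type_II :: "nat \<Rightarrow> complex mat \<Rightarrow> bool" where
  "type_II n M \<longleftrightarrow>
     M \<in> carrier_mat n n \<and> invertible_mat M \<and>
     (\<forall>i<n. \<forall>j<n. M $$ (i, j) \<noteq> 0) \<and>
     M * transpose_mat (schur_inverse M) = of_nat n \<cdot>\<^sub>m 1\<^sub>m n"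

text \<open>The vector \<open>M\<^bsub>i/j\<^esub>\<close>.\<close>

definition column_quotient :: "complex mat \<Rightarrow> nat \<Rightarrow> nat \<Rightarrow> complex vec" where
  "column_quotient M i j = vec (dim_row M) (\<lambda>r. col M i $ r / col M j $ r)"

definition spin_model :: "nat \<Rightarrow> complex mat \<Rightarrow> bool" where
  "spin_model n W \<longleftrightarrow>
     type_II n W \<and> (\<forall>i<n. \<forall>j<n. \<exists>\<theta>. eigenvector W (column_quotient W i j) \<theta>)"

definition unitary_mat :: "nat \<Rightarrow> complex mat \<Rightarrow> bool" where
  "unitary_mat n U \<longleftrightarrow>
     U \<in> carrier_mat n n \<and> U * mat_adjoint U = 1\<^sub>m n \<and> mat_adjoint U * U = 1\<^sub>m n"

text \<open>Bases are unordered; a basis of \<open>\<complex>\<^sup>n\<close> automatically has exactly \<open>n\<close> elements, so a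
  matrix with repeated columns never has a basis as its column set.\<close>

definition orthonormal_basis :: "nat \<Rightarrow> complex vec set \<Rightarrow> bool" where
  "orthonormal_basis n X \<longleftrightarrow>
     vectorspace.basis class_ring (module_vec TYPE(complex) n) X \<and>
     (\<forall>x\<in>X. \<forall>y\<in>X. x \<bullet>c y = (if x = y then 1 else 0))"

definition mutually_unbiased :: "nat \<Rightarrow> complex vec set \<Rightarrow> complex vec set \<Rightarrow> bool" where
  "mutually_unbiased n X Y \<longleftrightarrow>
     orthonormal_basis n X \<and> orthonormal_basis n Y \<and>
     (\<exists>a::real. \<forall>x\<in>X. \<forall>y\<in>Y. cmod (x \<bullet>c y) = a)"

text \<open>The bases are given as an indexed family, and unbiasedness is required for any two
  different indices; with a set of bases, a coincidence of two of them would hide a condition.\<close>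

definition mutually_unbiased_bases :: "nat \<Rightarrow> complex vec set list \<Rightarrow> bool" where
  "mutually_unbiased_bases n Bs \<longleftrightarrow>
     (\<forall>k<length Bs. \<forall>l<length Bs. k \<noteq> l \<longrightarrow> mutually_unbiased n (Bs ! k) (Bs ! l))"

definition column_set :: "complex mat \<Rightarrow> complex vec set" where
  "column_set M = set (cols M)"

definition D_mat :: "nat \<Rightarrow> complex mat \<Rightarrow> nat \<Rightarrow> complex mat" where
  "D_mat n A j =
     mat_diag n (\<lambda>r. col (complex_of_real (1 / sqrt (real n)) \<cdot>\<^sub>m schur_inverse A) j $ r)"

end

theory Submission
  imports Defs
begin

text \<open>Comparing \<open>A\<inverse> = A\<^sup>*\<close> with \<open>A\<inverse> = A\<^bsup>(-)T\<^esup> / n\<close> shows that all entries of \<open>A\<close> have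
  modulus \<open>1 / \<surd>n\<close>. Hence \<open>D\<^sub>j\<close> is unitary, \<open>D\<^sub>j A\<close> is a unitary matrix with entries of modulus
  \<open>1 / \<surd>n\<close>, and its \<open>k\<close>-th column is \<open>A\<^bsub>k/j\<^esub> / \<surd>n\<close>. The spin model condition makes this
  column an eigenvector of \<open>A\<close>, hence of \<open>A\<^sup>*\<close>, for an eigenvalue of modulus 1. The
  inner products of the columns of \<open>A\<close> with it are the entries of its image under \<open>A\<^sup>*\<close>, so
  they have modulus \<open>1 / \<surd>n\<close> as well.\<close>

section \<open>Inner products of columns in entries, and orthonormal columns as bases\<close>

lemma cscalar_prod_col:
  assumes "M \<in> carrier_mat n n" "N \<in> carrier_mat n n" "i < n" "k < n"
  shows "col M i \<bullet>c col N k = (\<Sum>r<n. M $$ (r, i) * cnj (N $$ (r, k)))"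
  using assms by (auto simp: scalar_prod_def lessThan_atLeast0 intro!: sum.cong)

lemma cmod_cscalar_prod_commute:
  assumes "dim_vec x = dim_vec y"
  shows "cmod (x \<bullet>c y) = cmod (y \<bullet>c x)"
proof -
  have "x \<bullet>c y = cnj (y \<bullet>c x)"
    using assms by (simp add: scalar_prod_def mult.commute)
  then show ?thesis by simp
qed

lemma mat_adjoint_index:
  assumes "M \<in> carrier_mat n n" "i < n" "k < n"
  shows "mat_adjoint M $$ (i, k) = cnj (M $$ (k, i))"
  using assms by (simp add: mat_adjoint_def mat_of_rows_def)

lemma mat_adjoint_carrier:
  assumes "M \<in> carrier_mat n n"
  shows "mat_adjoint M \<in> carrier_mat n n"
  using assms by (auto simp: mat_adjoint_def)

lemma column_set_conv:
  assumes "M \<in> carrier_mat n n"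
  shows "column_set M = col M ` {..<n}"
  using assms by (auto simp: column_set_def cols_def)

text \<open>Orthonormality says that the adjoint is a left inverse, so the determinant is nonzero
  and the columns are independent; \<open>n\<close> distinct independent vectors form a basis. The
  transpose enters because independence is drawn from a criterion for rows.\<close>

lemma orthonormal_basis_column_set:
  assumes M: "M \<in> carrier_mat n n"
    and orth: "\<And>i k. i < n \<Longrightarrow> k < n \<Longrightarrow> col M i \<bullet>c col M k = (if i = k then 1 else 0)"
  shows "orthonormal_basis n (column_set M)"
proof -
  interpret vec_space "TYPE(complex)" n .
  have adj: "mat_adjoint M * M = 1\<^sub>m n"
  proof (rule eq_matI)
    fix i k assume "i < dim_row (1\<^sub>m n :: complex mat)" "k < dim_col (1\<^sub>m n :: complex mat)"
    then have ik: "i < n" "k < n" by auto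
    have "(mat_adjoint M * M) $$ (i, k) = (\<Sum>r<n. cnj (M $$ (r, i)) * M $$ (r, k))"
      using ik M mat_adjoint_carrier[OF M] mat_adjoint_index[OF M]
      by (simp add: scalar_prod_def lessThan_atLeast0)
    also have "\<dots> = col M k \<bullet>c col M i"
      unfolding cscalar_prod_col[OF M M ik(2,1)] by (simp add: mult.commute)
    finally show "(mat_adjoint M * M) $$ (i, k) = 1\<^sub>m n $$ (i, k)"
      using ik orth by auto
  qed (use M mat_adjoint_carrier[OF M] in auto)
  have "det (mat_adjoint M) * det M = 1"
    using det_mult[OF mat_adjoint_carrier[OF M] M] adj by simp
  then have det: "det (transpose_mat M) \<noteq> 0"
    using det_transpose[OF M] by auto
  have "corthogonal (cols M)"
    using M orth by (intro corthogonalI) auto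
  then have dist: "card (column_set M) = n"
    using M corthogonal_distinct distinct_card unfolding column_set_def by fastforce
  have "lin_indpt (column_set M)"
    using det_not_0_imp_lin_indpt_rows[OF _ det] M by (simp add: column_set_def)
  then have "basis (column_set M)"
    using dist M cols_dim[of M]
    by (intro dim_li_is_basis) (auto simp: dim_is_n column_set_def)
  \<comment> \<open>The case distinction is here on equality of vectors, in \<open>orth\<close> on
    equality of indices. They agree: a repeated column would have inner product with itself both 0
    and 1.\<close>
  moreover have "\<forall>x\<in>column_set M. \<forall>y\<in>column_set M. x \<bullet>c y = (if x = y then 1 else 0)"
    using orth by (auto simp: column_set_conv[OF M]) (metis zero_neq_one)
  ultimately show ?thesis unfolding orthonormal_basis_def by simp
qed

section \<open>Unitary matrices: eigenvectors, and moduli of entries in the type-II case\<close>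

lemma mat_adjoint_mult_vec_index:
  fixes M :: "complex mat"
  assumes "M \<in> carrier_mat n n" "w \<in> carrier_vec n" "r < n"
  shows "(mat_adjoint M *\<^sub>v w) $ r = w \<bullet>c col M r"
  using assms mat_adjoint_index[of M n] mat_adjoint_carrier[of M n]
  by (auto simp: scalar_prod_def mult.commute intro!: sum.cong)

lemma cscalar_prod_mult_mat_vec:
  fixes M :: "complex mat"
  assumes M: "M \<in> carrier_mat n n" and v: "v \<in> carrier_vec n" and w: "w \<in> carrier_vec n"
  shows "(M *\<^sub>v v) \<bullet>c w = v \<bullet>c (mat_adjoint M *\<^sub>v w)"
proof -
  have "(M *\<^sub>v v) \<bullet>c w = (\<Sum>r<n. (\<Sum>s<n. M $$ (r, s) * v $ s) * cnj (w $ r))"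
    using M v w by (auto simp: scalar_prod_def lessThan_atLeast0 intro!: sum.cong)
  also have "\<dots> = (\<Sum>s<n. v $ s * (\<Sum>r<n. M $$ (r, s) * cnj (w $ r)))"
    unfolding sum_distrib_left sum_distrib_right by (subst sum.swap) (simp add: ac_simps)
  also have "\<dots> = (\<Sum>s<n. v $ s * cnj (w \<bullet>c col M s))"
    using M v w by (auto simp: scalar_prod_def lessThan_atLeast0 mult.commute intro!: sum.cong)
  also have "\<dots> = v \<bullet>c (mat_adjoint M *\<^sub>v w)"
    using M v w mat_adjoint_carrier[OF M]
    by (auto simp: mat_adjoint_mult_vec_index[OF M w, symmetric] scalar_prod_def[of v]
        lessThan_atLeast0 simp del: index_mult_mat_vec intro!: sum.cong)
  finally show ?thesis .
qed

text \<open>The adjoint of \<open>U\<close> takes \<open>\<theta> v = U v\<close> back to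
  \<open>v\<close>. Moving \<open>U\<close> across the inner product shows that
  \<open>\<theta> v\<close> and \<open>v\<close> have equal norm, so \<open>\<theta>\<close> has
  modulus 1; entry \<open>i\<close> of the adjoint equation then expresses \<open>v $ i\<close> as
  \<open>\<theta>\<close> times the inner product.\<close>

lemma unitary_eigenvector_cscalar_prod_col:
  assumes U: "unitary_mat n U" and v: "eigenvector U v \<theta>" and i: "i < n"
  shows "cmod (v \<bullet>c col U i) = cmod (v $ i)"
proof -
  have C: "U \<in> carrier_mat n n" using U by (simp add: unitary_mat_def)
  have vc: "v \<in> carrier_vec n" and v0: "v \<noteq> 0\<^sub>v n" and Uv: "U *\<^sub>v v = \<theta> \<cdot>\<^sub>v v"
    using v C by (auto simp: eigenvector_def)
  have adj: "mat_adjoint U *\<^sub>v (\<theta> \<cdot>\<^sub>v v) = v"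
    using U vc C mat_adjoint_carrier[OF C] Uv unfolding unitary_mat_def
    by (metis assoc_mult_mat_vec one_mult_mat_vec)
  have "(\<theta> \<cdot>\<^sub>v v) \<bullet>c (\<theta> \<cdot>\<^sub>v v) = v \<bullet>c v"
    using cscalar_prod_mult_mat_vec[OF C vc, of "\<theta> \<cdot>\<^sub>v v"] vc Uv adj by simp
  moreover have "(\<theta> \<cdot>\<^sub>v v) \<bullet>c (\<theta> \<cdot>\<^sub>v v) = \<theta> * cnj \<theta> * (v \<bullet>c v)"
    using vc by (simp add: conjugate_smult_vec)
  moreover have "v \<bullet>c v \<noteq> 0" using vc v0 by simp
  ultimately have "\<theta> * cnj \<theta> = 1" by simp
  then have "cmod \<theta> = 1"
    by (metis complex_mod_cnj norm_mult norm_one norm_ge_zero power2_eq_square power2_eq_1_iff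
        neg_0_le_iff_le not_one_le_zero)
  moreover have "v $ i = \<theta> * (v \<bullet>c col U i)"
    using mat_adjoint_mult_vec_index[OF C _ i, of "\<theta> \<cdot>\<^sub>v v"] adj vc C i by simp
  ultimately show ?thesis by (simp add: norm_mult)
qed

lemma unitary_type_II_cmod:
  assumes U: "unitary_mat n A" and T: "type_II n A" and i: "i < n" and k: "k < n"
  shows "cmod (A $$ (i, k)) = 1 / sqrt (real n)"
proof -
  let ?S = "transpose_mat (schur_inverse A)"
  have A: "A \<in> carrier_mat n n" and nz: "A $$ (i, k) \<noteq> 0"
    and AS: "A * ?S = of_nat n \<cdot>\<^sub>m 1\<^sub>m n"
    using T i k by (auto simp: type_II_def)
  have S: "?S \<in> carrier_mat n n" using A by (simp add: schur_inverse_def)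
  \<comment> \<open>Multiplying the type-II equation on the left by the adjoint isolates
    \<open>?S\<close> as \<open>n\<close> times the adjoint, to be compared entrywise.\<close>
  have "?S = (mat_adjoint A * A) * ?S" using U S by (simp add: unitary_mat_def)
  also have "\<dots> = mat_adjoint A * (A * ?S)"
    by (rule assoc_mult_mat[OF mat_adjoint_carrier[OF A] A S])
  also have "\<dots> = of_nat n \<cdot>\<^sub>m mat_adjoint A"
    using mat_adjoint_carrier[OF A] unfolding AS by (subst mult_smult_distrib) auto
  finally have "?S $$ (k, i) = (of_nat n \<cdot>\<^sub>m mat_adjoint A) $$ (k, i)" by simp
  then have "1 / A $$ (i, k) = of_nat n * cnj (A $$ (i, k))"
    using A i k mat_adjoint_index[OF A k i] mat_adjoint_carrier[OF A]
    by (simp add: schur_inverse_def)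
  then have "cmod (1 / A $$ (i, k)) = cmod (of_nat n * cnj (A $$ (i, k)))" by simp
  then have "1 / cmod (A $$ (i, k)) = real n * cmod (A $$ (i, k))"
    by (simp add: norm_divide norm_mult)
  then have "(cmod (A $$ (i, k)))\<^sup>2 = 1 / real n"
    using nz i by (simp add: field_simps power2_eq_square)
  then have "sqrt ((cmod (A $$ (i, k)))\<^sup>2) = sqrt (1 / real n)" by simp
  then show ?thesis by (simp add: real_sqrt_divide)
qed

section \<open>Mutual unbiasedness of column sets\<close>

lemma mutually_unbiased_commute:
  "mutually_unbiased n X Y \<longleftrightarrow> mutually_unbiased n Y X"
proof -
  have "mutually_unbiased n Y X" if XY: "mutually_unbiased n X Y" for X Y
  proof -
    \<comment> \<open>The scalar product sums over the dimension of its second argument, so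
      conjugate symmetry relies on equal dimensions; membership in a basis supplies them.\<close>
    have dim: "dim_vec x = n" if "orthonormal_basis n Z" "x \<in> Z" for x Z
    proof -
      interpret vec_space "TYPE(complex)" n .
      show ?thesis using that unfolding orthonormal_basis_def basis_def by auto
    qed
    then show ?thesis
      using XY cmod_cscalar_prod_commute unfolding mutually_unbiased_def by metis
  qed
  then show ?thesis by blast
qed

lemma mutually_unbiased_column_set:
  assumes "M \<in> carrier_mat n n" "N \<in> carrier_mat n n"
    and "orthonormal_basis n (column_set M)" "orthonormal_basis n (column_set N)"
    and "\<And>i k. i < n \<Longrightarrow> k < n \<Longrightarrow> cmod (col M i \<bullet>c col N k) = a"
  shows "mutually_unbiased n (column_set M) (column_set N)"
  using assms unfolding mutually_unbiased_def by (auto simp: column_set_conv)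

text \<open>If the sets coincided, column 0 of \<open>M\<close> would also be a column of
  \<open>N\<close>, and its inner product with itself would have modulus both 1 and
  \<open>a\<close>.\<close>

lemma column_set_neq:
  assumes "M \<in> carrier_mat n n" "N \<in> carrier_mat n n" "0 < n" "a \<noteq> 1"
    and M: "orthonormal_basis n (column_set M)"
    and flat: "\<And>i k. i < n \<Longrightarrow> k < n \<Longrightarrow> cmod (col M i \<bullet>c col N k) = a"
  shows "column_set M \<noteq> column_set N"
proof
  assume eq: "column_set M = column_set N"
  have x: "col M 0 \<in> column_set M" using assms by (auto simp: column_set_conv)
  then obtain k where k: "k < n" "col M 0 = col N k"
    unfolding eq using assms by (auto simp: column_set_conv)
  have "col M 0 \<bullet>c col M 0 = 1" using M x unfolding orthonormal_basis_def by auto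
  then have "cmod (col M 0 \<bullet>c col N k) = 1" unfolding k(2)[symmetric] by simp
  then show False using flat[OF \<open>0 < n\<close> k(1)] \<open>a \<noteq> 1\<close> by simp
qed

text \<open>Pairing with a standard basis vector reads off an entry up to conjugation, so
  unbiasedness to the standard basis means that all entries have one modulus.\<close>

lemma cmod_cscalar_prod_col_one:
  assumes "M \<in> carrier_mat n n" "i < n" "k < n"
  shows "cmod (col (1\<^sub>m n) i \<bullet>c col M k) = cmod (M $$ (i, k))"
proof -
  have "col (1\<^sub>m n) i \<bullet>c col M k = (\<Sum>r<n. 1\<^sub>m n $$ (r, i) * cnj (M $$ (r, k)))"
    using assms by (intro cscalar_prod_col) auto
  also have "\<dots> = (\<Sum>r<n. if r = i then cnj (M $$ (r, k)) else 0)"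
    using assms by (intro sum.cong) auto
  also have "\<dots> = cnj (M $$ (i, k))" using assms by simp
  finally show ?thesis by simp
qed

section \<open>The bases given by \<open>I\<close>, \<open>A\<close> and
  \<open>D_j A\<close>\<close>

theorem corollary8p3:
  fixes A :: "complex mat" and n :: nat
  assumes "unitary_mat n A"
    and "type_II n A"
    and "spin_model n A"
  shows "\<forall>j<n.
    mutually_unbiased_bases n
      [column_set (1\<^sub>m n), column_set A, column_set (D_mat n A j * A)] \<and>
    (2 \<le> n \<longrightarrow>
      distinct [column_set (1\<^sub>m n), column_set A, column_set (D_mat n A j * A)])"
proof (intro allI impI)
  fix j assume j: "j < n"
  define a where "a = 1 / sqrt (real n)"
  define B where "B = D_mat n A j * A"
  have A: "A \<in> carrier_mat n n" using assms(1) by (simp add: unitary_mat_def)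
  have modA: "cmod (A $$ (r, k)) = a" if "r < n" "k < n" for r k
    using unitary_type_II_cmod[OF assms(1,2) that] by (simp add: a_def)
  \<comment> \<open>Left multiplication by a diagonal matrix scales row \<open>r\<close> by its
    diagonal entry, here \<open>a / A $$ (r, j)\<close>.\<close>
  have B_index: "B $$ (r, k) = complex_of_real a / A $$ (r, j) * A $$ (r, k)"
    if "r < n" "k < n" for r k
    using that A j unfolding B_def D_mat_def
    by (subst mat_diag_mult_left[OF A]) (simp add: schur_inverse_def a_def)
  have B: "B \<in> carrier_mat n n"
    unfolding B_def D_mat_def by (rule mult_carrier_mat[OF mat_diag_dim A])
  have a0: "0 < a" using j by (simp add: a_def)
  have modD: "cmod (complex_of_real a / A $$ (r, j)) = 1" if "r < n" for r
    using modA[OF that j] a0 by (simp add: norm_divide)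
  have orthA: "col A i \<bullet>c col A k = (if i = k then 1 else 0)" if "i < n" "k < n" for i k
  proof -
    have "col A i \<bullet>c col A k = (mat_adjoint A *\<^sub>v col A i) $ k"
      using A that by (simp only: mat_adjoint_mult_vec_index[OF A] col_carrier_vec carrier_matD)
    also have "\<dots> = (mat_adjoint A * A) $$ (k, i)"
      using A that mat_adjoint_carrier[OF A] by simp
    finally show ?thesis using assms(1) that by (auto simp: unitary_mat_def)
  qed
  have orthB: "col B i \<bullet>c col B k = (if i = k then 1 else 0)" if "i < n" "k < n" for i k
  proof -
    \<comment> \<open>The scaling factor of row \<open>r\<close> has modulus 1, so it cancels
      against its conjugate in every summand.\<close>
    have "B $$ (r, i) * cnj (B $$ (r, k)) = A $$ (r, i) * cnj (A $$ (r, k))" if "r < n" for r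
    proof -
      let ?d = "complex_of_real a / A $$ (r, j)"
      have "?d * cnj ?d = 1"
        using modD[OF \<open>r < n\<close>] complex_norm_square[of ?d] by simp
      moreover have "B $$ (r, i) * cnj (B $$ (r, k)) =
          (?d * cnj ?d) * (A $$ (r, i) * cnj (A $$ (r, k)))"
        using that \<open>i < n\<close> \<open>k < n\<close> by (simp add: B_index)
      ultimately show ?thesis by simp
    qed
    then have "col B i \<bullet>c col B k = col A i \<bullet>c col A k"
      unfolding cscalar_prod_col[OF A A that] cscalar_prod_col[OF B B that] by simp
    then show ?thesis using orthA that by simp
  qed
  have orth1: "col (1\<^sub>m n) i \<bullet>c col (1\<^sub>m n) k = (if i = k then 1 else (0 :: complex))"
    if "i < n" "k < n" for i k
    using that by (simp add: unit_vec_def scalar_prod_def if_distrib cong: if_cong)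
  note basis = orthonormal_basis_column_set[OF A orthA] orthonormal_basis_column_set[OF B orthB]
    orthonormal_basis_column_set[OF one_carrier_mat orth1]
  have flat1A: "cmod (col (1\<^sub>m n) i \<bullet>c col A k) = a" if "i < n" "k < n" for i k
    using cmod_cscalar_prod_col_one[OF A that] modA[OF that] by simp
  have flat1B: "cmod (col (1\<^sub>m n) i \<bullet>c col B k) = a" if "i < n" "k < n" for i k
    using cmod_cscalar_prod_col_one[OF B that] modA[OF that] modA[OF that(1) j] a0
    by (simp add: B_index[OF that] norm_mult norm_divide)
  \<comment> \<open>\<open>B\<close> stands on the left because its columns are the eigenvectors of
    \<open>A\<close>; the other order follows by symmetry.\<close>
  have flatBA: "cmod (col B i \<bullet>c col A k) = a" if "i < n" "k < n" for i k
  proof -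
    let ?q = "column_quotient A i j"
    obtain \<theta> where \<theta>: "eigenvector A ?q \<theta>"
      using assms(3) \<open>i < n\<close> j by (auto simp: spin_model_def)
    have q: "?q \<in> carrier_vec n" using A by (auto simp: column_quotient_def)
    have "col B i = complex_of_real a \<cdot>\<^sub>v ?q"
      using A B j that by (auto simp: column_quotient_def B_index)
    then have "cmod (col B i \<bullet>c col A k) = cmod (complex_of_real a * (?q \<bullet>c col A k))"
      using q A by simp
    also have "\<dots> = a * cmod (?q $ k)"
      using unitary_eigenvector_cscalar_prod_col[OF assms(1) \<theta> that(2)] a0
      by (simp add: norm_mult)
    \<comment> \<open>A quotient of two entries of \<open>A\<close>, which share the modulus
      \<open>a\<close>.\<close>
    also have "cmod (?q $ k) = 1"
      using A that j modA a0 by (simp add: column_quotient_def norm_divide)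
    finally show ?thesis by simp
  qed
  note unbiased = mutually_unbiased_column_set[OF one_carrier_mat A basis(3,1) flat1A]
    mutually_unbiased_column_set[OF one_carrier_mat B basis(3,2) flat1B]
    mutually_unbiased_column_set[OF B A basis(2,1) flatBA]
  have "mutually_unbiased_bases n [column_set (1\<^sub>m n), column_set A, column_set B]"
    using unbiased mutually_unbiased_commute
    unfolding mutually_unbiased_bases_def by (auto simp: less_Suc_eq)
  \<comment> \<open>For \<open>n = 1\<close> the constant \<open>a\<close> is 1 and \<open>B\<close>
    is the identity matrix, so two of the sets coincide; from \<open>n = 2\<close> on,
    \<open>a < 1\<close> separates them.\<close>
  moreover have "distinct [column_set (1\<^sub>m n), column_set A, column_set B]" if "2 \<le> n"
  proof -
    have "a \<noteq> 1" using that by (simp add: a_def)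
    then show ?thesis
      using column_set_neq[OF one_carrier_mat A _ _ basis(3) flat1A]
        column_set_neq[OF one_carrier_mat B _ _ basis(3) flat1B]
        column_set_neq[OF B A _ _ basis(2) flatBA] j by auto
  qed
  ultimately show "mutually_unbiased_bases n
      [column_set (1\<^sub>m n), column_set A, column_set (D_mat n A j * A)] \<and>
    (2 \<le> n \<longrightarrow>
      distinct [column_set (1\<^sub>m n), column_set A, column_set (D_mat n A j * A)])"
    unfolding B_def by blast
qed

end
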